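(* Let $G$ be a finite simple graph on $n$ vertices and $m$ edges, with maximum vertex degree $\Delta$ and minimum vertex degree $\delta$. Then $$\frac{\delta n}{\sqrt{2}}\,(n-1-\Delta)\;\leq\; \overline{SO}(G)\;\leq\; \frac{\Delta n}{\sqrt{2}}\,(n-1-\delta).$$ Equality holds (in both inequalities) if $G$ is a regular graph.
   Context: All graphs are finite and simple, with nonempty vertex set. $d_G(u)$ denotes the degree of the vertex $u$ in $G$, and $\overline{G}$ is the complement of $G$. The Sombor coindex of $G$ is $$\overline{SO}(G)=\sum_{uv\in E(\overline{G})}\sqrt{d_G(u)^2+d_G(v)^2},$$ the sum being over unordered pairs of distinct vertices that are non-adjacent in $G$; the degrees are taken in $G$, not in $\overline{G}$. *)

theory Defs
  imports Complex_Main "Graph_Theory.Pair_Digraph"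
begin

text \<open>
  A finite simple graph is a \<^locale>\<open>pair_graph\<close>: finite vertex set, and a symmetric loop-free
  arc relation on it, each undirected edge being represented by its two opposite arcs.  Hence the
  number of edges at a vertex is its \<^const>\<open>out_degree\<close>.
\<close>

definition vdegree :: "'a pair_pre_digraph \<Rightarrow> 'a \<Rightarrow> nat" where
  "vdegree G v = out_degree (with_proj G) v"

definition edge_set :: "'a pair_pre_digraph \<Rightarrow> 'a set set" where
  "edge_set G = {{u, v} |u v. (u, v) \<in> parcs G}"

definition complement :: "'a pair_pre_digraph \<Rightarrow> 'a pair_pre_digraph" where
  "complement G =
     \<lparr>pverts = pverts G,
      parcs = {(u, v). u \<in> pverts G \<and> v \<in> pverts G \<and> u \<noteq> v \<and> (u, v) \<notin> parcs G}\<rparr>"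

definition max_degree :: "'a pair_pre_digraph \<Rightarrow> nat" where
  "max_degree G = Max (vdegree G ` pverts G)"

definition min_degree :: "'a pair_pre_digraph \<Rightarrow> nat" where
  "min_degree G = Min (vdegree G ` pverts G)"

definition regular :: "'a pair_pre_digraph \<Rightarrow> bool" where
  "regular G \<longleftrightarrow> (\<exists>k. \<forall>v\<in>pverts G. vdegree G v = k)"

text \<open>
  An edge is a two-element set, so the inner sum over the endpoints of \<open>e = {u, v}\<close> is
  \<open>d(u)^2 + d(v)^2\<close>; see \<open>sum_edge\<close> below.  The degrees are those of \<open>G\<close>, not of its complement.
\<close>

definition sombor_coindex :: "'a pair_pre_digraph \<Rightarrow> real" where
  "sombor_coindex G =
     (\<Sum>e\<in>edge_set (complement G). sqrt (\<Sum>w\<in>e. (real (vdegree G w))\<^sup>2))"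

lemma sum_edge:
  assumes "u \<noteq> v"
  shows "(\<Sum>w\<in>{u, v}. (real (vdegree G w))\<^sup>2) = (real (vdegree G u))\<^sup>2 + (real (vdegree G v))\<^sup>2"
  using assms by simp

lemma pair_graph_complement:
  assumes "pair_graph G"
  shows "pair_graph (complement G)"
proof -
  interpret pair_graph G by fact
  have sub: "parcs (complement G) \<subseteq> pverts G \<times> pverts G"
    by (auto simp: complement_def)
  have fin: "finite (parcs (complement G))"
    using finite_subset[OF sub] pair_finite_verts by simp
  have sym: "symmetric (with_proj (complement G))"
    using pair_sym_arcs by (auto simp: symmetric_def sym_def complement_def)
  show ?thesis
    using fin sym pair_finite_verts by unfold_locales (auto simp: complement_def)
qed

end

theory Submission
  imports Defs
begin

text \<open>
  Every endpoint degree lies between \<open>\<delta>\<close> and \<open>\<Delta>\<close>, so each summand of the Sombor coindex lies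
  between \<open>sqrt 2 * \<delta>\<close> and \<open>sqrt 2 * \<Delta>\<close>; it remains to estimate the number of summands, which is
  the number of edges of the complement.  A vertex of degree \<open>d\<close> has degree \<open>n - 1 - d\<close> in the
  complement (\<open>vdegree_complement\<close>), and by the handshake lemma (\<open>handshake\<close>) half the sum of these
  numbers is that edge count, which therefore lies between \<open>n (n - 1 - \<Delta>) / 2\<close> and
  \<open>n (n - 1 - \<delta>) / 2\<close>.  The product of the estimates gives the two bounds.  In a regular graph
  \<open>\<delta> = \<Delta>\<close>, so both bounds are the same number and the coindex is squeezed between them.
\<close>

text \<open>
  Both sides count the arcs: grouping them by tail gives the degree sum, and grouping them by their
  underlying edge puts exactly the two orientations of an edge into each group.
\<close>
lemma handshake:
  assumes "pair_graph H"
  shows "2 * card (edge_set H) = (\<Sum>v\<in>pverts H. vdegree H v)"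
proof -
  interpret pair_graph H by fact
  let ?edge = "\<lambda>a. {fst a, snd a}"
  have edges: "edge_set H = ?edge ` parcs H"
    by (force simp: edge_set_def)
  have two: "card {a \<in> parcs H. ?edge a = e} = 2" if "e \<in> edge_set H" for e
  proof -
    from that obtain u v where uv: "e = {u, v}" "(u, v) \<in> parcs H"
      by (auto simp: edge_set_def)
    moreover have "(v, u) \<in> parcs H"
      using uv(2) arcs_symmetric by blast
    moreover have "u \<noteq> v"
      using uv(2) pair_no_loops by fastforce
    ultimately have "{a \<in> parcs H. ?edge a = e} = {(u, v), (v, u)}"
      by (auto simp: doubleton_eq_iff)
    with \<open>u \<noteq> v\<close> show ?thesis by simp
  qed
  have "card (parcs H) = (\<Sum>e\<in>edge_set H. card {a \<in> parcs H. ?edge a = e})"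
    using sum.group[of "parcs H" "edge_set H" ?edge "\<lambda>_. 1::nat"]
    by (simp add: edges)
  also have "\<dots> = 2 * card (edge_set H)"
    by (simp add: two)
  finally have "card (parcs H) = 2 * card (edge_set H)" .
  moreover have "card (parcs H) = (\<Sum>v\<in>pverts H. card {a \<in> parcs H. fst a = v})"
    using sum.group[of "parcs H" "pverts H" fst "\<lambda>_. 1::nat"] in_arcsD1
    by (auto simp: image_subset_iff)
  ultimately show ?thesis
    by (simp add: vdegree_def out_degree_def out_arcs_def)
qed

lemma vdegree_eq_card_neighbours: "vdegree G v = card {w. (v, w) \<in> parcs G}"
proof -
  have "out_arcs (with_proj G) v = Pair v ` {w. (v, w) \<in> parcs G}"
    by (auto simp: out_arcs_def)
  then show ?thesis
    by (simp add: vdegree_def out_degree_def card_image inj_on_def)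
qed

text \<open>
  The other vertices split into the neighbours of \<open>v\<close> in the graph and those in the complement.
\<close>
lemma vdegree_complement:
  assumes "pair_graph G" and "v \<in> pverts G"
  shows "vdegree G v + vdegree (complement G) v + 1 = card (pverts G)"
proof -
  interpret pair_graph G by fact
  let ?N = "{w. (v, w) \<in> parcs G}" and ?C = "{w. (v, w) \<in> parcs (complement G)}"
  have verts: "insert v (?N \<union> ?C) = pverts G"
    using assms(2) in_arcsD1 in_arcsD2 by (auto simp: complement_def)
  moreover from this have "finite ?N" "finite ?C"
    using pair_finite_verts by (metis finite_Un finite_insert)+
  moreover have "v \<notin> ?N \<union> ?C" "?N \<inter> ?C = {}"
    using pair_no_loops by (fastforce simp: complement_def)+
  ultimately have "card (pverts G) = Suc (card ?N + card ?C)"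
    by (metis card_Un_disjoint card_insert_disjoint finite_UnI)
  then show ?thesis
    by (simp add: vdegree_eq_card_neighbours)
qed

lemma card_edges_complement:
  assumes "pair_graph G"
  shows "2 * real (card (edge_set (complement G))) =
         (\<Sum>v\<in>pverts G. real (card (pverts G)) - 1 - real (vdegree G v))"
proof -
  have "2 * real (card (edge_set (complement G))) =
        real (\<Sum>v\<in>pverts (complement G). vdegree (complement G) v)"
    using handshake[OF pair_graph_complement[OF assms]] by linarith
  also have "\<dots> = (\<Sum>v\<in>pverts G. real (vdegree (complement G) v))"
    by (simp add: complement_def)
  also have "\<dots> = (\<Sum>v\<in>pverts G. real (card (pverts G)) - 1 - real (vdegree G v))"
    using vdegree_complement[OF assms] by (intro sum.cong) force+
  finally show ?thesis .
qed

lemma sqrt_sum_squares_between: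
  fixes a b x y :: real
  assumes "0 \<le> a" "a \<le> x" "x \<le> b" "a \<le> y" "y \<le> b"
  shows "sqrt 2 * a \<le> sqrt (x\<^sup>2 + y\<^sup>2)" and "sqrt (x\<^sup>2 + y\<^sup>2) \<le> sqrt 2 * b"
proof -
  have "a\<^sup>2 \<le> x\<^sup>2" "a\<^sup>2 \<le> y\<^sup>2" "x\<^sup>2 \<le> b\<^sup>2" "y\<^sup>2 \<le> b\<^sup>2"
    using assms by (auto intro!: power_mono)
  then have "sqrt (2 * a\<^sup>2) \<le> sqrt (x\<^sup>2 + y\<^sup>2)" "sqrt (x\<^sup>2 + y\<^sup>2) \<le> sqrt (2 * b\<^sup>2)"
    by auto
  with assms show "sqrt 2 * a \<le> sqrt (x\<^sup>2 + y\<^sup>2)" "sqrt (x\<^sup>2 + y\<^sup>2) \<le> sqrt 2 * b"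
    by (auto simp: real_sqrt_mult)
qed

text \<open>
  The coindex is compared with the constant summands \<open>sqrt 2 * a\<close> and \<open>sqrt 2 * b\<close> before the
  number of summands is estimated: only the nonnegative factors \<open>a\<close> and \<open>b\<close> then multiply an
  inequality, so it does no harm that \<open>n - 1 - b\<close> may be negative.
\<close>
lemma sombor_coindex_bounds:
  fixes a b :: nat
  assumes G: "pair_graph G"
    and deg: "\<And>v. v \<in> pverts G \<Longrightarrow> a \<le> vdegree G v \<and> vdegree G v \<le> b"
  defines "n \<equiv> real (card (pverts G))"
  shows "real a * n / sqrt 2 * (n - 1 - real b) \<le> sombor_coindex G"
    and "sombor_coindex G \<le> real b * n / sqrt 2 * (n - 1 - real a)"
proof -
  let ?E = "edge_set (complement G)"
  let ?k = "real (card ?E)"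
  let ?term = "\<lambda>e. sqrt (\<Sum>w\<in>e. (real (vdegree G w))\<^sup>2)"
  have "sqrt 2 * real a \<le> ?term e \<and> ?term e \<le> sqrt 2 * real b" if "e \<in> ?E" for e
  proof -
    from that obtain u v where "e = {u, v}" "u \<in> pverts G" "v \<in> pverts G" "u \<noteq> v"
      by (auto simp: edge_set_def complement_def)
    then show ?thesis
      using deg[of u] deg[of v]
      by (auto simp: sum_edge intro!: sqrt_sum_squares_between[where a = a and b = b])
  qed
  then have sum_bounds:
    "?k * (sqrt 2 * real a) \<le> sombor_coindex G" "sombor_coindex G \<le> ?k * (sqrt 2 * real b)"
    unfolding sombor_coindex_def by (auto intro!: sum_bounded_below sum_bounded_above)
  have "n * (n - 1 - real b) \<le> 2 * ?k" "2 * ?k \<le> n * (n - 1 - real a)"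
    using deg unfolding card_edges_complement[OF G] n_def
    by (auto intro!: sum_bounded_below sum_bounded_above)
  then have
    "real a / sqrt 2 * (n * (n - 1 - real b)) \<le> real a / sqrt 2 * (2 * ?k)"
    "real b / sqrt 2 * (2 * ?k) \<le> real b / sqrt 2 * (n * (n - 1 - real a))"
    by (intro mult_left_mono; simp)+
  moreover have "c / sqrt 2 * (2 * ?k) = ?k * (sqrt 2 * c)" for c :: real
    by (simp add: field_simps)
  ultimately show
    "real a * n / sqrt 2 * (n - 1 - real b) \<le> sombor_coindex G"
    "sombor_coindex G \<le> real b * n / sqrt 2 * (n - 1 - real a)"
    using sum_bounds by (simp_all add: mult.assoc)
qed

theorem theorem3p2:
  fixes G :: "'a pair_pre_digraph" and n m \<Delta> \<delta> :: nat
  assumes "pair_graph G"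
    and "pverts G \<noteq> {}"
    and "n = card (pverts G)"
    and "m = card (edge_set G)"
    and "\<Delta> = max_degree G"
    and "\<delta> = min_degree G"
  shows "real \<delta> * real n / sqrt 2 * (real n - 1 - real \<Delta>) \<le> sombor_coindex G
       \<and> sombor_coindex G \<le> real \<Delta> * real n / sqrt 2 * (real n - 1 - real \<delta>)
       \<and> (regular G \<longrightarrow>
            real \<delta> * real n / sqrt 2 * (real n - 1 - real \<Delta>) = sombor_coindex G
          \<and> sombor_coindex G = real \<Delta> * real n / sqrt 2 * (real n - 1 - real \<delta>))"
proof -
  interpret pair_graph G by fact
  have degrees: "finite (vdegree G ` pverts G)" "vdegree G ` pverts G \<noteq> {}"
    using assms(2) pair_finite_verts by simp_all
  have "\<delta> \<le> vdegree G v \<and> vdegree G v \<le> \<Delta>" if "v \<in> pverts G" for v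
    using that degrees(1) assms(5,6) by (simp add: max_degree_def min_degree_def)
  note bounds = sombor_coindex_bounds[OF assms(1) this, folded assms(3)]
  have "\<delta> = \<Delta>" if "regular G"
  proof -
    from that obtain k where "vdegree G ` pverts G = {k}"
      using assms(2) by (fastforce simp: regular_def)
    then show ?thesis
      using assms(5,6) by (simp add: max_degree_def min_degree_def)
  qed
  with bounds show ?thesis
    by (auto intro: antisym)
qed

end
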